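(* Let $p\in\{13,29\}$. Then for every Dehn $p$-colorable knot $K$, \[ \mathrm{mincol}_p(K)\ \ge\ \lfloor \log_2 p\rfloor+3 . \] (That is, $\mathrm{mincol}_{13}(K)\ge 6$ and $\mathrm{mincol}_{29}(K)\ge 7$ for all Dehn $13$-, resp. $29$-colorable knots $K$.)
   Context: Let $p$ be an odd prime and $\mathbb Z_p=\mathbb Z/p\mathbb Z$. Let $D$ be a diagram of a knot and $\mathcal R(D)$ its set of regions. At a crossing, label the four surrounding regions $x_1,x_2,x_3,x_4$ so that $x_2$ is adjacent to $x_1$ across an under-arc, $x_3$ is adjacent to $x_1$ across the over-arc, and $x_4$ is the region opposite to $x_1$. A Dehn $p$-coloring of $D$ is a map $C:\mathcal R(D)\to\mathbb Z_p$ such that at every crossing $C(x_1)+C(x_3)=C(x_2)+C(x_4)$ (this condition does not depend on which of the four regions is chosen as $x_1$). A crossing is trivially colored by $C$ if $C(x_1)=C(x_4)$ and $C(x_2)=C(x_3)$; $C$ is trivial if every crossing is trivially colored (equivalently, $C$ is constant or a checkerboard coloring), and nontrivial otherwise. A knot $K$ is Dehn $p$-colorable if some diagram of $K$ admits a nontrivial Dehn $p$-coloring. For such $K$, $\mathrm{mincol}_p(K)$ denotes the minimum, over all diagrams $D$ of $K$ and all nontrivial Dehn $p$-colorings $C$ of $D$, of the number $\#C(\mathcal R(D))$ of distinct colors used. *)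

theory Defs
  imports Complex_Main "HOL-Number_Theory.Cong"
begin

(* Combinatorial model of a knot diagram with n crossings (as a 4-valent map on the sphere).
   Darts (half-edges) are 0..<4n; dart d sits at crossing d div 4, in counterclockwise
   position d mod 4.  rot is the counterclockwise rotation at a crossing;
   alpha is the fixed-point-free involution pairing the two darts of each edge.
   over c means that darts 4c and 4c+2 form the over-arc at crossing c
   (otherwise darts 4c+1 and 4c+3 do). *)

definition rot :: "nat \<Rightarrow> nat" where
  "rot d = 4 * (d div 4) + (d mod 4 + 1) mod 4"

definition orbit :: "('a \<Rightarrow> 'a) \<Rightarrow> 'a \<Rightarrow> 'a set" where
  "orbit f x = {(f ^^ k) x | k. True}"

(* corner d = the angle from dart d counterclockwise to dart rot d;
   walking around a face sends corner d to corner alpha (rot d). *)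
definition face_perm :: "(nat \<Rightarrow> nat) \<Rightarrow> nat \<Rightarrow> nat" where
  "face_perm \<alpha> d = \<alpha> (rot d)"

definition regions :: "nat \<Rightarrow> (nat \<Rightarrow> nat) \<Rightarrow> nat set set" where
  "regions n \<alpha> = {orbit (face_perm \<alpha>) d | d. d < 4 * n}"

definition corner_region :: "(nat \<Rightarrow> nat) \<Rightarrow> nat \<Rightarrow> nat \<Rightarrow> nat set" where
  "corner_region \<alpha> c k = orbit (face_perm \<alpha>) (4 * c + k)"

(* going straight through crossings along the curve: out along dart d, arrive at alpha d,
   leave through the opposite dart *)
definition strand_perm :: "(nat \<Rightarrow> nat) \<Rightarrow> nat \<Rightarrow> nat" where
  "strand_perm \<alpha> d = rot (rot (\<alpha> d))"

(* (n, alpha) is the underlying map of a knot diagram: alpha is an edge pairing,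
   the curve has exactly one component (two traversal directions = two strand orbits),
   and the map is planar (Euler: V - E + F = n - 2n + F = 2). *)
definition knot_diagram :: "nat \<Rightarrow> (nat \<Rightarrow> nat) \<Rightarrow> bool" where
  "knot_diagram n \<alpha> \<longleftrightarrow>
     (\<forall>d < 4 * n. \<alpha> d < 4 * n \<and> \<alpha> d \<noteq> d \<and> \<alpha> (\<alpha> d) = d) \<and>
     card {orbit (strand_perm \<alpha>) d | d. d < 4 * n} = 2 \<and>
     card (regions n \<alpha>) = n + 2"

(* Dehn p-coloring: colors in Z_p represented by 0..p-1. With x1 = corner 0:
   if darts 0,2 are over then x3 = corner 3 (across dart 0), x2 = corner 1, x4 = corner 2;
   otherwise x3 = corner 1, x2 = corner 3, x4 = corner 2. *)
definition dehn_coloring ::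
  "nat \<Rightarrow> nat \<Rightarrow> (nat \<Rightarrow> nat) \<Rightarrow> (nat \<Rightarrow> bool) \<Rightarrow> (nat set \<Rightarrow> int) \<Rightarrow> bool" where
  "dehn_coloring p n \<alpha> over C \<longleftrightarrow>
     (\<forall>R \<in> regions n \<alpha>. 0 \<le> C R \<and> C R < int p) \<and>
     (\<forall>c < n.
        (if over c
         then [C (corner_region \<alpha> c 0) + C (corner_region \<alpha> c 3)
               = C (corner_region \<alpha> c 1) + C (corner_region \<alpha> c 2)] (mod int p)
         else [C (corner_region \<alpha> c 0) + C (corner_region \<alpha> c 1)
               = C (corner_region \<alpha> c 3) + C (corner_region \<alpha> c 2)] (mod int p)))"

definition trivially_colored :: "(nat \<Rightarrow> nat) \<Rightarrow> (nat set \<Rightarrow> int) \<Rightarrow> nat \<Rightarrow> bool" where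
  "trivially_colored \<alpha> C c \<longleftrightarrow>
     C (corner_region \<alpha> c 0) = C (corner_region \<alpha> c 2) \<and>
     C (corner_region \<alpha> c 1) = C (corner_region \<alpha> c 3)"

definition nontrivial_dehn_coloring ::
  "nat \<Rightarrow> nat \<Rightarrow> (nat \<Rightarrow> nat) \<Rightarrow> (nat \<Rightarrow> bool) \<Rightarrow> (nat set \<Rightarrow> int) \<Rightarrow> bool" where
  "nontrivial_dehn_coloring p n \<alpha> over C \<longleftrightarrow>
     dehn_coloring p n \<alpha> over C \<and> (\<exists>c < n. \<not> trivially_colored \<alpha> C c)"

end

theory Submission
  imports Defs
begin

text \<open>Take a nontrivial coloring of the given diagram with as few colors as possible, and let \<open>S\<close> be
  its set of colors. A function \<open>y\<close> from \<open>S\<close> to the field with two elements that satisfies all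
  crossing relations modulo 2 has a constant sum \<open>y(R) + y(R')\<close> over adjacent regions, because the
  knot has a single component. Hence \<open>y\<close> is constant or induces a checkerboard coloring of the
  regions; in the latter case one of the two classes of colors can be translated onto the other
  so that two colors merge, contradicting minimality. So every such \<open>y\<close> is constant.

  Consequently \<open>S\<close> contains a three-term progression, which an affine change of colors turns into
  \<open>0, 1, 2\<close>. Among the sets of at most 5 residues modulo 13 (at most 6 modulo 29) containing
  \<open>0, 1, 2\<close>, the only ones without a nonconstant \<open>y\<close> are affinely equivalent to \<open>{0, 1, 2, 4, 7}\<close>
  (to \<open>{0, 1, 2, 4, 8, 15}\<close>). In these the relation \<open>1 + 7 = 4 + 4\<close> (\<open>1 + 15 = 8 + 8\<close>) cannot occur
  at a crossing, since the colors beside its under-arcs would persist along the whole knot; and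
  without this relation the indicator of \<open>7\<close> (of \<open>15\<close>) is an admissible \<open>y\<close>.\<close>

section \<open>Knot diagrams\<close>

text \<open>The colors are listed in the order \<open>x1, x2, x3, x4\<close> of the paper: \<open>x1\<close> and \<open>x3\<close> meet along the
  over-arc, \<open>x1\<close> and \<open>x2\<close> along an under-arc.\<close>

definition crossing_colors ::
  "(nat \<Rightarrow> nat) \<Rightarrow> (nat \<Rightarrow> bool) \<Rightarrow> (nat set \<Rightarrow> int) \<Rightarrow> nat \<Rightarrow> int \<times> int \<times> int \<times> int" where
  "crossing_colors \<alpha> over C c =
     (let x = (\<lambda>k. C (corner_region \<alpha> c k))
      in if over c then (x 0, x 1, x 3, x 2) else (x 0, x 3, x 1, x 2))"

lemma dehn_coloring_iff:
  "dehn_coloring p n \<alpha> over C \<longleftrightarrow>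
     C ` regions n \<alpha> \<subseteq> {0..<int p} \<and>
     (\<forall>c<n. \<forall>x1 x2 x3 x4. crossing_colors \<alpha> over C c = (x1, x2, x3, x4) \<longrightarrow>
        [x1 + x3 = x2 + x4] (mod int p))"
  unfolding dehn_coloring_def crossing_colors_def Let_def by auto

lemma trivially_colored_iff:
  assumes "crossing_colors \<alpha> over C c = (x1, x2, x3, x4)"
  shows "trivially_colored \<alpha> C c \<longleftrightarrow> x1 = x4 \<and> x2 = x3"
  using assms unfolding trivially_colored_def crossing_colors_def Let_def
  by (auto split: if_splits)

section \<open>Rotation at a crossing and orbits of permutations\<close>

lemma rot_simps:
  "rot (4 * c) = 4 * c + 1" "rot (4 * c + 1) = 4 * c + 2"
  "rot (4 * c + 2) = 4 * c + 3" "rot (4 * c + 3) = 4 * c"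
  unfolding rot_def by presburger+

lemma dart_cases:
  fixes d :: nat
  obtains c where "d = 4 * c" | c where "d = 4 * c + 1" | c where "d = 4 * c + 2"
    | c where "d = 4 * c + 3"
proof -
  have "d mod 4 = 0 \<or> d mod 4 = 1 \<or> d mod 4 = 2 \<or> d mod 4 = 3" by presburger
  moreover have "d = 4 * (d div 4) + d mod 4" by simp
  ultimately show thesis using that by (metis add.right_neutral)
qed

lemma rot_less: "d < 4 * n \<Longrightarrow> rot d < 4 * n"
  unfolding rot_def by presburger

lemma rot_rot_rot_rot: "rot (rot (rot (rot d))) = d"
  by (cases d rule: dart_cases) (simp_all only: rot_simps)

lemma rot_rot_neq: "rot (rot d) \<noteq> d"
  by (cases d rule: dart_cases) (simp_all only: rot_simps)

lemma in_orbit_self: "x \<in> orbit f x"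
  unfolding orbit_def by (auto intro: exI[of _ 0])

text \<open>An injective self-map of a finite set runs in cycles, so \<open>x\<close> is reached
  again from \<open>f x\<close>.\<close>

lemma orbit_step:
  assumes "\<And>x. x \<in> A \<Longrightarrow> f x \<in> A" "inj_on f A" "finite A" "x \<in> A"
  shows "orbit f (f x) = orbit f x"
proof -
  \<comment> \<open>Extending \<open>f\<close> by the identity outside \<open>A\<close> makes it
    injective everywhere, while the iterates starting at \<open>x\<close> stay the same.\<close>
  define g where "g = (\<lambda>x. if x \<in> A then f x else x)"
  have inj: "inj g"
    using assms(1,2) by (auto simp: inj_def g_def inj_on_def)
  have pow: "(f ^^ k) x \<in> A \<and> (g ^^ k) x = (f ^^ k) x" for k
    by (induction k) (auto simp: g_def assms)
  have "finite {y. \<exists>k. y = (g ^^ k) x}"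
    by (rule finite_subset[OF _ assms(3)]) (use pow in auto)
  from funpow_inj_finite[OF inj this]
  obtain k where "k > 0" "(g ^^ k) x = x" by blast
  then obtain j where j: "(f ^^ Suc j) x = x" using pow by (metis Suc_pred)
  have "(f ^^ i) x = (f ^^ (i + j)) (f x)" for i
    using j by (simp add: funpow_add funpow_swap1)
  moreover have "(f ^^ i) (f x) = (f ^^ Suc i) x" for i
    by (simp add: funpow_swap1)
  ultimately show ?thesis unfolding orbit_def by blast
qed

section \<open>Strands and faces of a knot diagram\<close>

locale knot =
  fixes n :: nat and \<alpha> :: "nat \<Rightarrow> nat"
  assumes knot: "knot_diagram n \<alpha>"
begin

lemma alpha_less: "d < 4 * n \<Longrightarrow> \<alpha> d < 4 * n"
  and alpha_neq: "d < 4 * n \<Longrightarrow> \<alpha> d \<noteq> d"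
  and alpha_alpha: "d < 4 * n \<Longrightarrow> \<alpha> (\<alpha> d) = d"
  using knot by (auto simp: knot_diagram_def)

lemma strand_less: "d < 4 * n \<Longrightarrow> strand_perm \<alpha> d < 4 * n"
  by (simp add: strand_perm_def rot_less alpha_less)

text \<open>The curve cannot return along an edge in the opposite direction: removing one step at
  each end of such a path leaves one shorter by two, until \<alpha> or a double rotation would have
  a fixed point. Hence \<open>d\<close> and \<open>\<alpha> d\<close> lie in different strand
  orbits.\<close>

lemma strand_not_reversed: "d < 4 * n \<Longrightarrow> (strand_perm \<alpha> ^^ k) d \<noteq> \<alpha> d"
proof (induction k arbitrary: d rule: nat_induct2)
  case 0
  then show ?case using alpha_neq[of d] by auto
next
  case 1
  then show ?case using rot_rot_neq by (simp add: strand_perm_def)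
next
  case (step k)
  let ?s = "strand_perm \<alpha>"
  show ?case
  proof
    assume "(?s ^^ (k + 2)) d = \<alpha> d"
    then have *: "?s ((?s ^^ k) (?s d)) = \<alpha> d"
      by (simp add: funpow_swap1)
    define e where "e = (?s ^^ k) (?s d)"
    have e: "e < 4 * n"
      unfolding e_def using step.prems by (induction k) (simp_all add: strand_less)
    from * have "rot (rot (\<alpha> e)) = \<alpha> d" by (simp add: e_def strand_perm_def)
    then have "\<alpha> e = rot (rot (\<alpha> d))" by (metis rot_rot_rot_rot)
    then have "e = \<alpha> (?s d)" using e by (metis alpha_alpha strand_perm_def)
    with step.IH[OF strand_less[OF step.prems]] show False by (simp add: e_def)
  qed
qed

text \<open>The two strand orbits are the two orientations of the curve, so a function on darts that
  is preserved by reversing a dart and by going straight through a crossing is constant.\<close>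

lemma strand_invariant_constant:
  assumes \<alpha>: "\<And>d. d < 4 * n \<Longrightarrow> g (\<alpha> d) = g d"
    and rot: "\<And>d. d < 4 * n \<Longrightarrow> g (rot (rot d)) = g d"
    and d: "d < 4 * n" and e: "e < 4 * n"
  shows "g d = g e"
proof -
  let ?s = "strand_perm \<alpha>"
  let ?O = "{orbit ?s d | d. d < 4 * n}"
  have orb: "x < 4 * n \<and> g x = g y" if "x \<in> orbit ?s y" "y < 4 * n" for x y
  proof -
    have "(?s ^^ k) y < 4 * n \<and> g ((?s ^^ k) y) = g y" for k
    proof (induction k)
      case (Suc k)
      then have "g (?s ((?s ^^ k) y)) = g ((?s ^^ k) y)"
        by (simp add: strand_perm_def[of \<alpha> "(?s ^^ k) y"] alpha_less rot \<alpha>)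
      with Suc show ?case by (simp add: strand_less)
    qed (use that in simp)
    with that show ?thesis by (auto simp: orbit_def)
  qed
  have "\<alpha> d \<notin> orbit ?s d"
  proof
    assume "\<alpha> d \<in> orbit ?s d"
    then obtain k where "\<alpha> d = (?s ^^ k) d" by (auto simp: orbit_def)
    with strand_not_reversed[OF d, of k] show False by simp
  qed
  then have "orbit ?s d \<noteq> orbit ?s (\<alpha> d)" using in_orbit_self by metis
  then have two: "card {orbit ?s d, orbit ?s (\<alpha> d)} = card ?O"
    using knot by (simp add: knot_diagram_def)
  have sub: "{orbit ?s d, orbit ?s (\<alpha> d)} \<subseteq> ?O"
    using d alpha_less[OF d] by blast
  have "finite ?O" by simp
  then have "{orbit ?s d, orbit ?s (\<alpha> d)} = ?O" using sub two by (rule card_subset_eq)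
  moreover have "orbit ?s e \<in> ?O" using e by blast
  ultimately have "orbit ?s e \<in> {orbit ?s d, orbit ?s (\<alpha> d)}" by (simp only:)
  then have "e \<in> orbit ?s d \<or> e \<in> orbit ?s (\<alpha> d)"
    using in_orbit_self[of e ?s] by auto
  then show ?thesis
    using orb[of e d] orb[of e "\<alpha> d"] d alpha_less[OF d] \<alpha>[OF d] by auto
qed

lemma region_alpha_rot:
  assumes "d < 4 * n"
  shows "orbit (face_perm \<alpha>) (\<alpha> (rot d)) = orbit (face_perm \<alpha>) d"
proof -
  have "inj_on (face_perm \<alpha>) {..<4 * n}"
  proof
    fix x y assume xy: "x \<in> {..<4 * n}" "y \<in> {..<4 * n}" "face_perm \<alpha> x = face_perm \<alpha> y"
    then have "rot x = rot y" by (metis alpha_alpha face_perm_def lessThan_iff rot_less)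
    then show "x = y" by (metis rot_rot_rot_rot)
  qed
  from orbit_step[OF _ this, of d] show ?thesis
    using assms by (simp add: face_perm_def alpha_less rot_less)
qed

lemma crossing_colors_in:
  assumes "c < n" "crossing_colors \<alpha> over C c = (x1, x2, x3, x4)"
  shows "{x1, x2, x3, x4} \<subseteq> C ` regions n \<alpha>"
proof -
  have "C (corner_region \<alpha> c k) \<in> C ` regions n \<alpha>" if "k < 4" for k
    using assms(1) that by (auto simp: corner_region_def regions_def intro!: imageI exI[of _ "4 * c + k"])
  from this[of 0] this[of 1] this[of 2] this[of 3] assms(2) show ?thesis
    by (auto simp: crossing_colors_def Let_def split: if_splits)
qed

section \<open>Colors on the two sides of an edge\<close>

context
  fixes C :: "nat set \<Rightarrow> int" and over :: "nat \<Rightarrow> bool"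
begin

definition corner_color :: "nat \<Rightarrow> int" where
  "corner_color d = C (orbit (face_perm \<alpha>) d)"

lemma corner_color_alpha_rot: "d < 4 * n \<Longrightarrow> corner_color (\<alpha> (rot d)) = corner_color d"
  by (simp add: corner_color_def region_alpha_rot)

lemma corner_color_alpha: "d < 4 * n \<Longrightarrow> corner_color (\<alpha> d) = corner_color (rot (rot (rot d)))"
  using corner_color_alpha_rot[of "rot (rot (rot d))"] by (simp add: rot_less rot_rot_rot_rot)

lemma colors_eq: "C ` regions n \<alpha> = corner_color ` {..<4 * n}"
  by (auto simp: corner_color_def regions_def)

lemma crossing_colors_eq:
  "crossing_colors \<alpha> over C c =
    (if over c
     then (corner_color (4 * c), corner_color (4 * c + 1), corner_color (4 * c + 3), corner_color (4 * c + 2))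
     else (corner_color (4 * c), corner_color (4 * c + 3), corner_color (4 * c + 1), corner_color (4 * c + 2)))"
  by (simp add: crossing_colors_def corner_region_def corner_color_def)

text \<open>The pairs \<open>x1, x3\<close> and \<open>x2, x4\<close> lie beside the two halves of
  the over-arc, \<open>x1, x2\<close> and \<open>x3, x4\<close> beside the two under-arcs. So
  \<open>inv\<close> carries the value of \<open>F\<close> straight through every crossing, and a
  curve with one component visits every edge.\<close>

lemma adjacent_invariant_constant:
  assumes sym: "\<And>x y. F x y = F y x"
    and inv: "\<forall>c<n. \<forall>x1 x2 x3 x4. crossing_colors \<alpha> over C c = (x1, x2, x3, x4) \<longrightarrow>
      F x1 x3 = F x2 x4 \<and> F x1 x2 = F x3 x4"
  obtains v where "\<And>d. d < 4 * n \<Longrightarrow> F (corner_color d) (corner_color (rot d)) = v"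
proof -
  \<comment> \<open>The corners \<open>d\<close> and \<open>\<alpha> d\<close> lie on opposite sides
    of the edge of \<open>d\<close>.\<close>
  define g where "g d = F (corner_color d) (corner_color (\<alpha> d))" for d
  have g_rot: "g (rot d) = F (corner_color d) (corner_color (rot d))" if "d < 4 * n" for d
    using that sym by (simp add: g_def corner_color_alpha_rot)
  have "g (\<alpha> d) = g d" if "d < 4 * n" for d
    using sym that by (simp add: g_def alpha_alpha)
  moreover have "g (rot (rot (rot d))) = g (rot d)" if d: "d < 4 * n" for d
  proof -
    have x: "F (corner_color (4 * c)) (corner_color (4 * c + 1)) = F (corner_color (4 * c + 2)) (corner_color (4 * c + 3)) \<and>
       F (corner_color (4 * c)) (corner_color (4 * c + 3)) = F (corner_color (4 * c + 1)) (corner_color (4 * c + 2))"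
      if "c < n" for c
      using inv[rule_format, OF that crossing_colors_eq[THEN trans]] sym by (cases "over c") simp_all
    show ?thesis
      unfolding g_rot[OF rot_less[OF rot_less[OF d]]] g_rot[OF d]
      using d x by (cases d rule: dart_cases) (simp_all add: rot_simps rot_simps[simplified] sym)
  qed
  then have "g (rot (rot d)) = g d" if "d < 4 * n" for d
    using that by (metis rot_less rot_rot_rot_rot)
  ultimately have "g d = g (rot 0)" if "d < 4 * n" for d
    using strand_invariant_constant[of g d "rot 0"] that rot_less[of 0 n] by simp
  then have "F (corner_color d) (corner_color (rot d)) = g (rot 0)" if "d < 4 * n" for d
    using that by (metis g_rot rot_less)
  then show thesis by (rule that)
qed

text \<open>The over-arc and the under-arcs at a crossing are pieces of the same curve, so
  \<open>F\<close> takes the same value beside both.\<close>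

lemma adjacent_invariant_crossing:
  assumes sym: "\<And>x y. F x y = F y x"
    and inv: "\<forall>c<n. \<forall>x1 x2 x3 x4. crossing_colors \<alpha> over C c = (x1, x2, x3, x4) \<longrightarrow>
      F x1 x3 = F x2 x4 \<and> F x1 x2 = F x3 x4"
    and c: "c < n" "crossing_colors \<alpha> over C c = (x1, x2, x3, x4)"
  shows "F x1 x3 = F x1 x2"
proof -
  obtain v where v: "\<And>d. d < 4 * n \<Longrightarrow> F (corner_color d) (corner_color (rot d)) = v"
    using adjacent_invariant_constant[OF sym inv] by blast
  have "F (corner_color (4 * c)) (corner_color (4 * c + 1)) = v"
    using v[of "4 * c"] c(1) by (simp add: rot_simps)
  moreover have "F (corner_color (4 * c + 3)) (corner_color (4 * c)) = v"
    using v[of "4 * c + 3"] c(1) unfolding rot_simps by simp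
  ultimately show ?thesis
    using c(2) sym unfolding crossing_colors_eq by (auto split: if_splits)
qed

end

text \<open>In the checkerboard case each side of a crossing relation contains exactly one color
  with \<open>y\<close> true. Translating all those colors by a constant therefore preserves the
  relations, and a suitable constant merges two colors.\<close>

lemma minimal_parity_constant:
  assumes C: "nontrivial_dehn_coloring p n \<alpha> over C"
    and min: "\<And>C'. nontrivial_dehn_coloring p n \<alpha> over C' \<Longrightarrow>
      card (C ` regions n \<alpha>) \<le> card (C' ` regions n \<alpha>)"
    and y: "\<And>c x1 x2 x3 x4. c < n \<Longrightarrow> crossing_colors \<alpha> over C c = (x1, x2, x3, x4) \<Longrightarrow>
      (y x1 \<longleftrightarrow> y x3) = (y x2 \<longleftrightarrow> y x4)"
    and ab: "a \<in> C ` regions n \<alpha>" "b \<in> C ` regions n \<alpha>"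
  shows "y a = y b"
proof (rule ccontr)
  assume neq: "y a \<noteq> y b"
  obtain v where v: "\<And>d. d < 4 * n \<Longrightarrow> (y (corner_color C d) = y (corner_color C (rot d))) = v"
  proof -
    \<comment> \<open>The four parities at a crossing have sum zero modulo 2, so they can be paired
      in either way.\<close>
    have "\<forall>c<n. \<forall>x1 x2 x3 x4. crossing_colors \<alpha> over C c = (x1, x2, x3, x4) \<longrightarrow>
      (y x1 = y x3) = (y x2 = y x4) \<and> (y x1 = y x2) = (y x3 = y x4)"
      using y by blast
    from adjacent_invariant_constant[where F = "\<lambda>s t. y s = y t", OF _ this] show thesis
      using that by blast
  qed
  show False
  proof (cases v)
    case True
    have r: "y (corner_color C (rot d)) = y (corner_color C d)" if "d < 4 * n" for d
      using v[OF that] True by simp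
    have "y (corner_color C d) = y (corner_color C e)" if "d < 4 * n" "e < 4 * n" for d e
      by (rule strand_invariant_constant[of "\<lambda>d. y (corner_color C d)"])
        (simp_all add: that r rot_less corner_color_alpha)
    with neq ab show False unfolding colors_eq by blast
  next
    case False
    \<comment> \<open>Whichever of \<open>a\<close> and \<open>b\<close> has \<open>y\<close> true
      is moved onto the other.\<close>
    define t where "t = (if y a then b - a else a - b)"
    define f where "f x = (if y x then (x + t) mod int p else x)" for x
    have f_cong: "[f x = x + (if y x then t else 0)] (mod int p)" for x
      by (simp add: f_def cong_def)
    have dehn: "dehn_coloring p n \<alpha> over C" using C by (simp add: nontrivial_dehn_coloring_def)
    then have range: "C ` regions n \<alpha> \<subseteq> {0..<int p}" by (simp add: dehn_coloring_iff)
    have p: "int p > 0" using range ab by force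
    have cc: "crossing_colors \<alpha> over (f \<circ> C) c = (f x1, f x2, f x3, f x4)"
      if "crossing_colors \<alpha> over C c = (x1, x2, x3, x4)" for c x1 x2 x3 x4
      using that by (auto simp: crossing_colors_def Let_def split: if_splits)
    have board: "y x1 \<noteq> y x2" "y x1 \<noteq> y x3" "y x2 \<noteq> y x4" "y x3 \<noteq> y x4"
      if "c < n" "crossing_colors \<alpha> over C c = (x1, x2, x3, x4)" for c x1 x2 x3 x4
    proof -
      have "y (corner_color C (4 * c)) \<noteq> y (corner_color C (4 * c + 1))"
        "y (corner_color C (4 * c + 1)) \<noteq> y (corner_color C (4 * c + 2))"
        "y (corner_color C (4 * c + 2)) \<noteq> y (corner_color C (4 * c + 3))"
        "y (corner_color C (4 * c + 3)) \<noteq> y (corner_color C (4 * c))"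
        using v[of "4 * c"] v[of "4 * c + 1"] v[of "4 * c + 2"] v[of "4 * c + 3"] False that(1)
        unfolding rot_simps by simp_all
      with that(2) show "y x1 \<noteq> y x2" "y x1 \<noteq> y x3" "y x2 \<noteq> y x4" "y x3 \<noteq> y x4"
        unfolding crossing_colors_eq by (auto split: if_splits)
    qed
    have "dehn_coloring p n \<alpha> over (f \<circ> C)"
      unfolding dehn_coloring_iff
    proof (intro conjI allI impI)
      show "(f \<circ> C) ` regions n \<alpha> \<subseteq> {0..<int p}"
        using range p by (auto simp: f_def)
    next
      fix c x1 x2 x3 x4
      assume c: "c < n" and eq: "crossing_colors \<alpha> over (f \<circ> C) c = (x1, x2, x3, x4)"
      obtain z1 z2 z3 z4 where z: "crossing_colors \<alpha> over C c = (z1, z2, z3, z4)"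
        by (metis prod_cases4)
      then have x: "x1 = f z1" "x2 = f z2" "x3 = f z3" "x4 = f z4" using cc[OF z] eq by simp_all
      have "[z1 + z3 = z2 + z4] (mod int p)" using dehn c z by (simp add: dehn_coloring_iff)
      then have "[z1 + z3 + t = z2 + z4 + t] (mod int p)" by (rule cong_add) simp
      moreover have "[f z1 + f z3 = z1 + z3 + t] (mod int p)"
        using cong_add[OF f_cong[of z1] f_cong[of z3]] board(2)[OF c z]
        by (cases "y z1") (simp_all add: ac_simps)
      moreover have "[f z2 + f z4 = z2 + z4 + t] (mod int p)"
        using cong_add[OF f_cong[of z2] f_cong[of z4]] board(3)[OF c z]
        by (cases "y z2") (simp_all add: ac_simps)
      ultimately show "[x1 + x3 = x2 + x4] (mod int p)"
        unfolding x by (simp add: cong_def)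
    qed
    moreover obtain c where c: "c < n" "\<not> trivially_colored \<alpha> C c"
      using C by (auto simp: nontrivial_dehn_coloring_def)
    moreover have "\<not> trivially_colored \<alpha> (f \<circ> C) c"
    proof -
      obtain z1 z2 z3 z4 where z: "crossing_colors \<alpha> over C c = (z1, z2, z3, z4)"
        by (metis prod_cases4)
      have zr: "{z1, z2, z3, z4} \<subseteq> {0..<int p}" using crossing_colors_in[OF c(1) z] range by blast
      \<comment> \<open>The opposite colors \<open>z1, z4\<close> and \<open>z2, z3\<close> have
        equal parity, and \<open>f\<close> is injective on colors of equal parity; so the crossing
        stays nontrivially colored.\<close>
      have inj: "s = s'" if "f s = f s'" "y s = y s'" "{s, s'} \<subseteq> {0..<int p}" for s s'
      proof -
        have "[s + t = s' + t] (mod int p) \<or> s = s'" using that by (auto simp: f_def cong_def split: if_splits)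
        then have "[s = s'] (mod int p)" by (auto simp: cong_add_rcancel)
        with that(3) show ?thesis by (simp add: cong_def)
      qed
      show ?thesis
        using c(2) board[OF c(1) z] inj[of z1 z4] inj[of z2 z3] zr
        unfolding trivially_colored_iff[OF z] trivially_colored_iff[OF cc[OF z]] by blast
    qed
    ultimately have "nontrivial_dehn_coloring p n \<alpha> over (f \<circ> C)"
      by (auto simp: nontrivial_dehn_coloring_def)
    from min[OF this] have "card (C ` regions n \<alpha>) \<le> card (f ` C ` regions n \<alpha>)"
      by (simp add: image_comp)
    moreover have fin: "finite (C ` regions n \<alpha>)"
      using range by (rule finite_subset) simp
    ultimately have "card (f ` C ` regions n \<alpha>) = card (C ` regions n \<alpha>)"
      using card_image_le[OF fin, of f] by linarith
    then have "inj_on f (C ` regions n \<alpha>)" using fin by (rule eq_card_imp_inj_on[rotated])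
    moreover have "f a = f b" using neq ab range by (auto simp: f_def t_def)
    ultimately show False using ab neq by (auto dest: inj_onD)
  qed
qed

end

section \<open>Affine changes of colors\<close>

lemma affine_nontrivial_coloring:
  assumes C: "nontrivial_dehn_coloring p n \<alpha> over C" and t: "coprime t (int p)" and p: "p > 0"
    and K: "knot_diagram n \<alpha>"
  shows "nontrivial_dehn_coloring p n \<alpha> over (\<lambda>R. (t * (C R - a)) mod int p)"
    and "card ((\<lambda>R. (t * (C R - a)) mod int p) ` regions n \<alpha>) = card (C ` regions n \<alpha>)"
proof -
  interpret knot n \<alpha> by unfold_locales (rule K)
  let ?f = "\<lambda>x. (t * (x - a)) mod int p"
  have dehn: "dehn_coloring p n \<alpha> over C" using C by (simp add: nontrivial_dehn_coloring_def)
  then have range: "C ` regions n \<alpha> \<subseteq> {0..<int p}" by (simp add: dehn_coloring_iff)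
  have inj: "inj_on ?f {0..<int p}"
  proof
    fix x y assume xy: "x \<in> {0..<int p}" "y \<in> {0..<int p}" "?f x = ?f y"
    then have "[t * (x - a) = t * (y - a)] (mod int p)" by (simp add: cong_def)
    then have "[x - a = y - a] (mod int p)" using t by (simp add: cong_mult_lcancel)
    then have "[x - a + a = y - a + a] (mod int p)" by (rule cong_add) simp
    then show "x = y" using xy by (simp add: cong_def)
  qed
  have cc: "crossing_colors \<alpha> over (\<lambda>R. ?f (C R)) c = (?f x1, ?f x2, ?f x3, ?f x4)"
    if "crossing_colors \<alpha> over C c = (x1, x2, x3, x4)" for c x1 x2 x3 x4
    using that by (auto simp: crossing_colors_def Let_def split: if_splits)
  have "dehn_coloring p n \<alpha> over (\<lambda>R. ?f (C R))"
    unfolding dehn_coloring_iff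
  proof (intro conjI allI impI)
    fix c x1 x2 x3 x4
    assume c: "c < n" and eq: "crossing_colors \<alpha> over (\<lambda>R. ?f (C R)) c = (x1, x2, x3, x4)"
    obtain z1 z2 z3 z4 where z: "crossing_colors \<alpha> over C c = (z1, z2, z3, z4)"
      by (metis prod_cases4)
    then have x: "x1 = ?f z1" "x2 = ?f z2" "x3 = ?f z3" "x4 = ?f z4" using cc[OF z] eq by simp_all
    have "[z1 + z3 = z2 + z4] (mod int p)" using dehn c z by (simp add: dehn_coloring_iff)
    \<comment> \<open>Both sides of a relation have two terms, so the shift by \<open>a\<close>
      contributes \<open>2 * t * a\<close> to each.\<close>
    then have "[t * (z1 + z3) - 2 * t * a = t * (z2 + z4) - 2 * t * a] (mod int p)"
      by (intro cong_diff cong_mult) simp_all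
    then have "[t * (z1 - a) + t * (z3 - a) = t * (z2 - a) + t * (z4 - a)] (mod int p)"
      by (simp add: algebra_simps)
    then show "[x1 + x3 = x2 + x4] (mod int p)"
      unfolding x cong_def by (simp only: mod_add_eq)
  qed (use p in auto)
  moreover obtain c where c: "c < n" "\<not> trivially_colored \<alpha> C c"
    using C by (auto simp: nontrivial_dehn_coloring_def)
  moreover have "\<not> trivially_colored \<alpha> (\<lambda>R. ?f (C R)) c"
  proof -
    obtain z1 z2 z3 z4 where z: "crossing_colors \<alpha> over C c = (z1, z2, z3, z4)"
      by (metis prod_cases4)
    have zr: "{z1, z2, z3, z4} \<subseteq> {0..<int p}" using crossing_colors_in[OF c(1) z] range by blast
    show ?thesis
      using c(2) inj_onD[OF inj, of z1 z4] inj_onD[OF inj, of z2 z3] zr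
      unfolding trivially_colored_iff[OF z] trivially_colored_iff[OF cc[OF z]] by blast
  qed
  ultimately show "nontrivial_dehn_coloring p n \<alpha> over (\<lambda>R. ?f (C R))"
    by (auto simp: nontrivial_dehn_coloring_def)
  have "card (?f ` C ` regions n \<alpha>) = card (C ` regions n \<alpha>)"
    by (rule card_image[OF inj_on_subset[OF inj range]])
  then show "card ((\<lambda>R. ?f (C R)) ` regions n \<alpha>) = card (C ` regions n \<alpha>)"
    by (simp add: image_image)
qed

section \<open>Parities on sets of residues\<close>

text \<open>The relation is demanded for all quadruples with equal sums, whether or not a crossing
  realises them, so that the condition depends on the color set alone.\<close>

definition respects_sums :: "int \<Rightarrow> int set \<Rightarrow> (int \<Rightarrow> bool) \<Rightarrow> bool" where
  "respects_sums p S y \<longleftrightarrow> (\<forall>x1\<in>S. \<forall>x2\<in>S. \<forall>x3\<in>S. \<forall>x4\<in>S.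
     [x1 + x3 = x2 + x4] (mod p) \<longrightarrow> (y x1 \<longleftrightarrow> y x3) = (y x2 \<longleftrightarrow> y x4))"

lemma residue_eqI: "[x = z] (mod p) \<Longrightarrow> x \<in> {0..<p} \<Longrightarrow> z \<in> {0..<p} \<Longrightarrow> x = (z :: int)"
  by (simp add: cong_def)

lemma residue_sum_cases:
  fixes p :: int
  assumes "[x1 + x3 = x2 + x4] (mod p)" "{x1, x2, x3, x4} \<subseteq> {0..<p}"
  shows "x1 = x2 \<longleftrightarrow> x3 = x4" "x1 = x4 \<longleftrightarrow> x3 = x2"
proof -
  have *: "[x1 + x3 = x4 + x2] (mod p)" using assms(1) by (simp add: add.commute)
  show "x1 = x2 \<longleftrightarrow> x3 = x4" "x1 = x4 \<longleftrightarrow> x3 = x2"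
    using assms cong_add_lcancel[of x1 x3 x4 p] cong_add_rcancel[of x1 x3 x2 p]
      * cong_add_lcancel[of x1 x3 x2 p] cong_add_rcancel[of x1 x3 x4 p] residue_eqI
    by blast+
qed

text \<open>If \<open>S\<close> contains a quadruple with \<open>a + b = c + d\<close>, then the parity separating it from
  the rest of \<open>S\<close> works: any relation between three elements of the quadruple and an outside
  element \<open>z\<close> exhibits \<open>z\<close> as an end of a three-term progression.\<close>

lemma progression_free_respects_sums:
  fixes p :: int
  assumes S: "S \<subseteq> {0..<p}" "card S \<le> 6" and p: "odd p"
    and st: "s \<in> S" "t \<in> S" "s \<noteq> t"
    and free: "\<And>a b m. a \<in> S \<Longrightarrow> b \<in> S \<Longrightarrow> m \<in> S \<Longrightarrow> [a + b = 2 * m] (mod p) \<Longrightarrow> a = b"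
  obtains y u v where "respects_sums p S y" "u \<in> S" "v \<in> S" "y u \<noteq> y v"
proof -
  have free': "a = m" if "a \<in> S" "b \<in> S" "m \<in> S" "[a + b = 2 * m] (mod p)" for a b m
  proof -
    from free[OF that] that(4) have "[2 * a = 2 * m] (mod p)" by simp
    then have "[a = m] (mod p)" using p by (simp add: cong_mult_lcancel)
    then show ?thesis using S(1) that by (auto intro: residue_eqI)
  qed
  \<comment> \<open>A repeated element on one side would be the middle of a progression, so every
    relation is either trivial or has four distinct elements.\<close>
  have dist: "(x1 = x2 \<and> x3 = x4) \<or> (x1 = x4 \<and> x3 = x2) \<or> distinct [x1, x2, x3, x4]"
    if x: "x1 \<in> S" "x2 \<in> S" "x3 \<in> S" "x4 \<in> S" "[x1 + x3 = x2 + x4] (mod p)" for x1 x2 x3 x4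
  proof -
    have r: "{x1, x2, x3, x4} \<subseteq> {0..<p}" using x S(1) by blast
    note residue_sum_cases[OF x(5) r]
    moreover have "x1 = x2" if "x1 = x3"
      using free'[of x2 x4 x1] x that by (simp add: cong_sym)
    moreover have "x1 = x2" if "x2 = x4"
      using free'[of x1 x3 x2] x that by simp
    ultimately show ?thesis by auto
  qed
  show thesis
  proof (cases "\<exists>a\<in>S. \<exists>b\<in>S. \<exists>c\<in>S. \<exists>d\<in>S. [a + b = c + d] (mod p) \<and> distinct [a, c, b, d]")
    case False
    \<comment> \<open>Only trivial relations remain, so the indicator of any single element
      works.\<close>
    have "respects_sums p S (\<lambda>x. x = s)"
      unfolding respects_sums_def using dist False by blast
    with st that[of "\<lambda>x. x = s" s t] show thesis by auto
  next
    case True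
    then obtain a b c d where abcd: "a \<in> S" "b \<in> S" "c \<in> S" "d \<in> S"
      and sum: "[a + b = c + d] (mod p)" and ne: "distinct [a, c, b, d]" by blast
    let ?B = "{a, b, c, d}"
    \<comment> \<open>These are the triples of distinct elements of \<open>?B\<close>, each taken
      once up to exchanging the last two entries.\<close>
    let ?R = "{(a, b, c), (a, b, d), (a, c, d), (b, a, c), (b, a, d), (b, c, d),
      (c, d, a), (c, d, b), (c, a, b), (d, c, a), (d, c, b), (d, a, b)}"
    \<comment> \<open>Adding the two relations and cancelling \<open>u + x\<close> leaves the
      progression \<open>z + x' = 2 * u'\<close>.\<close>
    have L1: "z = x'" if "[u + u' = x + x'] (mod p)" "[z + u = u' + x] (mod p)"
      "z \<in> S" "u' \<in> S" "x' \<in> S" for z u u' x x'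
    proof -
      have "[(z + u) + (x + x') = (u' + x) + (u + u')] (mod p)"
        by (rule cong_add[OF that(2) cong_sym[OF that(1)]])
      then have "[(z + x') + (u + x) = 2 * u' + (u + x)] (mod p)" by (simp add: algebra_simps)
      then have "[z + x' = 2 * u'] (mod p)" by (simp only: cong_add_rcancel)
      then show ?thesis using free that by blast
    qed
    have L2: "z = u'" if "[u + u' = x + x'] (mod p)" "[z + u = x + x'] (mod p)"
      "z \<in> S" "u' \<in> S" for z u u' x x'
    proof -
      have "[u + z = u + u'] (mod p)" using that(1,2) by (simp add: cong_def add.commute)
      then have "[z = u'] (mod p)" by (simp only: cong_add_lcancel)
      then show ?thesis using that S(1) by (auto intro: residue_eqI)
    qed
    have sums: "[a + b = c + d] (mod p)" "[a + b = d + c] (mod p)"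
      "[b + a = c + d] (mod p)" "[b + a = d + c] (mod p)"
      "[c + d = a + b] (mod p)" "[c + d = b + a] (mod p)"
      "[d + c = a + b] (mod p)" "[d + c = b + a] (mod p)"
      using sum by (simp_all add: cong_sym add.commute)
    have T': "z \<in> ?B" if "z \<in> S" "[z + u = v + w] (mod p)"
      "(u, v, w) \<in> ?R" for z u v w
      using that(3) L1[OF _ that(2) that(1)] L2[OF _ that(2) that(1)] sums abcd
      by (elim insertE emptyE) (simp only: prod.inject, blast)+
    have T: "z \<in> ?B" if "z \<in> S" "u \<in> ?B" "v \<in> ?B" "w \<in> ?B" "[z + u = v + w] (mod p)" for z u v w
    proof (rule ccontr)
      assume z: "z \<notin> ?B"
      have "u \<in> S" "v \<in> S" "w \<in> S" using that abcd by auto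
      with dist[of z v u w] that z have "distinct [u, v, w]" by auto
      with that(2-4) have "(u, v, w) \<in> ?R \<or> (u, w, v) \<in> ?R"
        by (elim insertE emptyE) simp_all
      then show False
      proof
        assume "(u, v, w) \<in> ?R"
        from notE[OF z T'[OF that(1,5) this]] show False .
      next
        have wv: "[z + u = w + v] (mod p)" using that(5) by (simp add: add.commute)
        assume "(u, w, v) \<in> ?R"
        from notE[OF z T'[OF that(1) wv this]] show False .
      qed
    qed
    have fin: "finite S" using S(1) finite_subset by blast
    show thesis
    proof (cases "S = ?B")
      case S_eq: True
      \<comment> \<open>The indicator of \<open>?B\<close> would be constant here. A nontrivial
        relation uses all four elements, and two of them, an even number, lie in
        \<open>{a, b}\<close>.\<close>
      have "respects_sums p S (\<lambda>x. x \<in> {a, b})"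
        unfolding respects_sums_def
      proof (intro ballI impI)
        fix x1 x2 x3 x4
        assume x: "x1 \<in> S" "x2 \<in> S" "x3 \<in> S" "x4 \<in> S" "[x1 + x3 = x2 + x4] (mod p)"
        from dist[OF x]
        show "((x1 \<in> {a, b}) = (x3 \<in> {a, b})) = ((x2 \<in> {a, b}) = (x4 \<in> {a, b}))"
          using x(1-4) ne unfolding S_eq by auto
      qed
      with that[of _ a c] abcd ne show thesis by auto
    next
      case False
      then obtain v where v: "v \<in> S" "v \<notin> ?B" using abcd by blast
      define B where "B = ?B"
      \<comment> \<open>With at most two elements outside \<open>B\<close>, a relation between four
        distinct elements has at least two in \<open>B\<close>; \<open>T\<close> excludes exactly
        three, so their number is even.\<close>
      have "card (S - B) \<le> 2"
        using S(2) ne abcd by (simp add: card_Diff_subset B_def)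
      then have out: False if "distinct [x, y, z]" "{x, y, z} \<subseteq> S - B" for x y z
        using that card_mono[OF _ that(2)] fin by simp
      have "respects_sums p S (\<lambda>x. x \<in> B)"
        unfolding respects_sums_def
      proof (intro ballI impI)
        fix x1 x2 x3 x4
        assume x: "x1 \<in> S" "x2 \<in> S" "x3 \<in> S" "x4 \<in> S" "[x1 + x3 = x2 + x4] (mod p)"
        from dist[OF x]
        show "((x1 \<in> B) = (x3 \<in> B)) = ((x2 \<in> B) = (x4 \<in> B))"
        proof (elim disjE)
          assume d: "distinct [x1, x2, x3, x4]"
          have perms: "[x3 + x1 = x2 + x4] (mod p)" "[x2 + x4 = x1 + x3] (mod p)" "[x4 + x2 = x1 + x3] (mod p)"
            using x(5) by (simp_all add: cong_sym add.commute)
          have "x1 \<in> B \<or> x2 \<in> B \<or> x3 \<in> B" "x1 \<in> B \<or> x2 \<in> B \<or> x4 \<in> B"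
            "x1 \<in> B \<or> x3 \<in> B \<or> x4 \<in> B" "x2 \<in> B \<or> x3 \<in> B \<or> x4 \<in> B"
            using out[of x1 x2 x3] out[of x1 x2 x4] out[of x1 x3 x4] out[of x2 x3 x4] d x(1-4) by auto
          moreover note T[folded B_def, OF x(1) _ _ _ x(5)] T[folded B_def, OF x(3) _ _ _ perms(1)]
            T[folded B_def, OF x(2) _ _ _ perms(2)] T[folded B_def, OF x(4) _ _ _ perms(3)]
          ultimately show ?thesis by blast
        qed auto
      qed
      with that[of _ a v] abcd v show thesis by (auto simp: B_def)
    qed
  qed
qed

section \<open>Exhaustive search\<close>

text \<open>The elements chosen so far are stored inside \<open>P\<close>, so no list of candidates
  is built, and the conditional stops the search at the first failure.\<close>

fun all_short_subseqs :: "('a list \<Rightarrow> bool) \<Rightarrow> nat \<Rightarrow> 'a list \<Rightarrow> bool" where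
  "all_short_subseqs P 0 xs = P []"
| "all_short_subseqs P (Suc k) [] = P []"
| "all_short_subseqs P (Suc k) (x # xs) =
     (if all_short_subseqs (\<lambda>ys. P (x # ys)) k xs then all_short_subseqs P (Suc k) xs else False)"

lemma all_short_subseqs_filter:
  "all_short_subseqs P k xs \<Longrightarrow> length (filter Q xs) \<le> k \<Longrightarrow> P (filter Q xs)"
  by (induction P k xs rule: all_short_subseqs.induct) (auto split: if_splits)

section \<open>Splitting a palette into two classes\<close>

fun two_colorings :: "'a list \<Rightarrow> 'a list \<Rightarrow> ('a list \<times> 'a list) list" where
  "two_colorings B [] = [(B, [])]"
| "two_colorings B (x # xs) =
     map (\<lambda>(B, W). (x # B, W)) (two_colorings B xs) @ map (\<lambda>(B, W). (B, x # W)) (two_colorings B xs)"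

lemma two_colorings_union:
  "(B', W) \<in> set (two_colorings B xs) \<Longrightarrow> set B' \<union> set W = set B \<union> set xs"
  by (induction xs arbitrary: B' W) fastforce+

lemma two_colorings_subset: "(B', W) \<in> set (two_colorings B xs) \<Longrightarrow> set B \<subseteq> set B'"
  by (induction xs arbitrary: B' W) fastforce+

text \<open>The conditionals make the simplifier evaluate the disjunctions lazily.\<close>

fun lazy_ex :: "('a \<Rightarrow> bool) \<Rightarrow> 'a list \<Rightarrow> bool" where
  "lazy_ex P [] = False"
| "lazy_ex P (x # xs) = (if P x then True else lazy_ex P xs)"

lemma lazy_ex_iff: "lazy_ex P xs \<longleftrightarrow> (\<exists>x\<in>set xs. P x)"
  by (induction xs) auto

text \<open>For two residues one conditional subtraction replaces the division.\<close>

definition add_mod :: "int \<Rightarrow> int \<Rightarrow> int \<Rightarrow> int" where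
  "add_mod p x y = (let s = x + y in if s < p then s else s - p)"

lemma add_mod_eq: "x \<in> {0..<p} \<Longrightarrow> y \<in> {0..<p} \<Longrightarrow> add_mod p x y = (x + y) mod p"
  using mod_pos_pos_trivial[of "x + y" p] mod_pos_pos_trivial[of "x + y - p" p] minus_mod_self2[of "x + y" p]
  by (simp add: add_mod_def Let_def)

lemma add_mod_commute: "add_mod p x y = add_mod p y x"
  by (simp add: add_mod_def add.commute)

fun pair_sums :: "int \<Rightarrow> int list \<Rightarrow> int list" where
  "pair_sums p [] = []"
| "pair_sums p (x # xs) = map (add_mod p x) (x # xs) @ pair_sums p xs"

lemma pair_sums_complete:
  "x \<in> set xs \<Longrightarrow> y \<in> set xs \<Longrightarrow> add_mod p x y \<in> set (pair_sums p xs)"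
proof (induction xs)
  case (Cons a xs)
  then consider "x = a" | "y = a" | "x \<in> set xs" "y \<in> set xs" by auto
  then show ?case
  proof cases
    case 2
    then have "add_mod p x y = add_mod p a x" by (simp add: add_mod_commute)
    with Cons.prems(1) show ?thesis by auto
  qed (use Cons in auto)
qed simp

text \<open>A relation violates the parity given by \<open>W\<close> exactly when one side mixes the
  classes and the other does not; a clash is such a relation.\<close>

definition sum_clash :: "int \<Rightarrow> int list \<times> int list \<Rightarrow> bool" where
  "sum_clash p BW = (case BW of (B, W) \<Rightarrow> let ss = pair_sums p B @ pair_sums p W in
     lazy_ex (\<lambda>w. lazy_ex (\<lambda>b. let s = add_mod p w b in lazy_ex (\<lambda>t. s = t) ss) B) W)"

text \<open>For a common element \<open>w\<close> the sum \<open>w + w\<close> would be both mixed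
  and unmixed.\<close>

lemma no_sum_clash_disjoint:
  assumes "\<not> sum_clash p (B, W)"
  shows "set B \<inter> set W = {}"
proof -
  have "sum_clash p (B, W)" if "w \<in> set B" "w \<in> set W" for w
    using that pair_sums_complete[OF that(1,1), of p]
    by (auto simp: sum_clash_def lazy_ex_iff Let_def)
  with assms show ?thesis by blast
qed

lemma no_sum_clash_respects_sums:
  assumes "\<not> sum_clash p (B, W)" "set B \<union> set W \<subseteq> {0..<p}"
  shows "respects_sums p (set B \<union> set W) (\<lambda>x. x \<in> set W)"
proof -
  have *: "[w + b \<noteq> x + y] (mod p)"
    if "w \<in> set W" "b \<in> set B" "x \<in> set B \<and> y \<in> set B \<or> x \<in> set W \<and> y \<in> set W" for w b x y
  proof -
    have "add_mod p x y \<in> set (pair_sums p B @ pair_sums p W)"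
      using that(3) by (auto intro: pair_sums_complete)
    moreover have "add_mod p w b \<notin> set (pair_sums p B @ pair_sums p W)"
      using assms(1) that(1,2) by (simp add: sum_clash_def lazy_ex_iff Let_def)
    ultimately have "add_mod p w b \<noteq> add_mod p x y" by metis
    moreover have "add_mod p w b = (w + b) mod p" "add_mod p x y = (x + y) mod p"
      using that assms(2) by (auto intro!: add_mod_eq)
    ultimately show ?thesis by (simp add: cong_def)
  qed
  show ?thesis
    unfolding respects_sums_def
  proof (intro ballI impI)
    fix x1 x2 x3 x4
    assume x: "x1 \<in> set B \<union> set W" "x2 \<in> set B \<union> set W" "x3 \<in> set B \<union> set W"
      "x4 \<in> set B \<union> set W" "[x1 + x3 = x2 + x4] (mod p)"
    have perms: "[x3 + x1 = x2 + x4] (mod p)" "[x2 + x4 = x1 + x3] (mod p)" "[x4 + x2 = x1 + x3] (mod p)"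
      using x(5) by (simp_all add: cong_sym add.commute)
    show "((x1 \<in> set W) = (x3 \<in> set W)) = ((x2 \<in> set W) = (x4 \<in> set W))"
      using *[of x1 x3 x2 x4] *[of x3 x1 x2 x4] *[of x2 x4 x1 x3] *[of x4 x2 x1 x3] x perms
      by blast
  qed
qed

text \<open>\<open>b\<close> occurs in no relation of \<open>S\<close> other than \<open>a + b = 2 m\<close>, and the pairs \<open>{m, a}\<close>, \<open>{m, b}\<close>
  share neither their sum nor their difference with any other pair, so that the under-arcs of a
  crossing realising \<open>a + b = 2 m\<close> could never connect to the rest of the knot.\<close>

definition isolated_progression :: "int \<Rightarrow> int set \<Rightarrow> int \<Rightarrow> int \<Rightarrow> int \<Rightarrow> bool" where
  "isolated_progression p S m a b \<longleftrightarrow>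
     m \<in> S \<and> a \<in> S \<and> b \<in> S \<and> m \<noteq> a \<and> m \<noteq> b \<and>
     (\<forall>x\<in>S. \<forall>y\<in>S. (y + m - x - a) mod p = 0 \<longrightarrow> (x = m \<and> y = a) \<or> (x = b \<and> y = m)) \<and>
     (\<forall>x\<in>S. \<forall>y\<in>S. (x + y - m - a) mod p = 0 \<longrightarrow> (x = m \<and> y = a) \<or> (x = a \<and> y = m)) \<and>
     (\<forall>x\<in>S. \<forall>y\<in>S. \<forall>z\<in>S. x \<noteq> b \<longrightarrow> y \<noteq> b \<longrightarrow> z \<noteq> b \<longrightarrow>
        (b + x - y - z) mod p = 0 \<longrightarrow> x = a \<and> y = m \<and> z = m)"

text \<open>Here \<open>xs\<close> lists the colors beside \<open>0\<close>, \<open>1\<close>,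
  \<open>2\<close>. Since \<open>0 + 2 = 1 + 1\<close>, the colors \<open>0\<close> and
  \<open>2\<close> have equal parity in every admissible splitting, so both start in the first
  class; a nonempty second class makes the parity nonconstant. Failing that, \<open>m\<close> and
  \<open>b\<close> are searched, and they determine \<open>a\<close>.\<close>

definition palette_check :: "int \<Rightarrow> int list \<Rightarrow> bool" where
  "palette_check p xs \<longleftrightarrow>
     (let ys = 0 # 1 # 2 # xs in
      if lazy_ex (\<lambda>BW. \<not> sum_clash p BW \<and> snd BW \<noteq> []) (two_colorings [0, 2] (1 # xs)) then True
      else lazy_ex (\<lambda>m. lazy_ex (\<lambda>b. let a = (2 * m - b) mod p in
        if a \<in> set ys \<and> b \<noteq> m then isolated_progression p (set ys) m a b else False) ys) ys)"

text \<open>Two colors beside \<open>0\<close>, \<open>1\<close>, \<open>2\<close> cover all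
  normalised palettes of at most five colors.\<close>

lemma palette_check_13: "all_short_subseqs (palette_check 13) 2 [3..12]"
  by code_simp

lemma palette_check_29: "all_short_subseqs (palette_check 29) 3 [3..28]"
  by code_simp

section \<open>Color sets of minimal colorings\<close>

context knot
begin

text \<open>Isolation makes adjacency of \<open>m\<close> with \<open>a\<close> or \<open>b\<close>
  invariant along the knot. A crossing realising \<open>a + b = 2 * m\<close> has it beside its
  under-arcs but not beside its over-arc, hence does not occur. Then the indicator of
  \<open>b\<close> satisfies all crossing relations modulo 2, although it differs at
  \<open>m\<close> and \<open>b\<close>.\<close>

lemma minimal_no_isolated_progression:
  assumes C: "nontrivial_dehn_coloring p n \<alpha> over C"
    and min: "\<And>C'. nontrivial_dehn_coloring p n \<alpha> over C' \<Longrightarrow>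
      card (C ` regions n \<alpha>) \<le> card (C' ` regions n \<alpha>)"
    and iso: "isolated_progression (int p) (C ` regions n \<alpha>) m a b"
    and mid: "[a + b = 2 * m] (mod int p)"
  shows False
proof -
  define S where "S = C ` regions n \<alpha>"
  have dehn: "dehn_coloring p n \<alpha> over C" using C by (simp add: nontrivial_dehn_coloring_def)
  then have S: "S \<subseteq> {0..<int p}" by (simp add: dehn_coloring_iff S_def)
  have "(u - v - w) mod int p = 0 \<longleftrightarrow> [u = v + w] (mod int p)" for u v w
    by (simp add: cong_iff_dvd_diff mod_eq_0_iff_dvd diff_diff_eq)
  note iso' = iso[folded S_def, unfolded isolated_progression_def this]
  have mab: "m \<in> S" "a \<in> S" "b \<in> S" "m \<noteq> a" "m \<noteq> b" using iso' by blast+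
  have diff: "(x = m \<and> y = a) \<or> (x = b \<and> y = m)"
    if "[y + m = x + a] (mod int p)" "x \<in> S" "y \<in> S" for x y
    using that iso' by blast
  have sum_ma: "(x = m \<and> y = a) \<or> (x = a \<and> y = m)"
    if "[x + y = m + a] (mod int p)" "x \<in> S" "y \<in> S" for x y
    using that iso' by blast
  have lone: "x = a \<and> y = m \<and> z = m"
    if "[b + x = y + z] (mod int p)" "x \<in> S" "y \<in> S" "z \<in> S" "x \<noteq> b" "y \<noteq> b" "z \<noteq> b" for x y z
    using that iso' by blast
  have cancel: "x1 = x2 \<longleftrightarrow> x3 = x4" "x1 = x4 \<longleftrightarrow> x3 = x2"
    if "[x1 + x3 = x2 + x4] (mod int p)" "{x1, x2, x3, x4} \<subseteq> S" for x1 x2 x3 x4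
    using residue_sum_cases[OF that(1)] that(2) S by blast+
  \<comment> \<open>If \<open>b\<close> were not among \<open>x\<close> and \<open>y\<close>, then
    \<open>lone\<close> applied to \<open>b + m = x + y\<close> would give
    \<open>m = a\<close>.\<close>
  have sum_mb: "(x = m \<and> y = b) \<or> (x = b \<and> y = m)"
    if "[x + y = m + b] (mod int p)" "x \<in> S" "y \<in> S" for x y
  proof (cases "x = b \<or> y = b")
    case True
    then show ?thesis using cancel[OF that(1)] that mab by auto
  next
    case False
    have "[b + m = x + y] (mod int p)" using that(1) by (simp add: cong_sym add.commute)
    with lone[of m x y] False mab that show ?thesis by blast
  qed

  define F where "F x y \<longleftrightarrow> x = m \<and> (y = a \<or> y = b) \<or> y = m \<and> (x = a \<or> x = b)" for x y
  have sym: "F x y = F y x" for x y by (auto simp: F_def)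
  \<comment> \<open>Along the over-arc the sum of the two adjacent colors persists; along the
    under-arcs, treated next, their difference does.\<close>
  have over_F: "F x2 x4"
    if "F x1 x3" "[x1 + x3 = x2 + x4] (mod int p)" "x2 \<in> S" "x4 \<in> S" for x1 x2 x3 x4
  proof -
    have "[x2 + x4 = m + a] (mod int p) \<or> [x2 + x4 = m + b] (mod int p)"
      using that(1,2) unfolding F_def by (auto simp: cong_sym add.commute)
    then show ?thesis using sum_ma[of x2 x4] sum_mb[of x2 x4] that by (auto simp: F_def)
  qed
  have under_F: "F x3 x4"
    if F: "F x1 x2" and r: "[x1 + x3 = x2 + x4] (mod int p)" and x: "x3 \<in> S" "x4 \<in> S" for x1 x2 x3 x4
  proof -
    \<comment> \<open>As \<open>m - b = a - m\<close>, differences of the pair \<open>m, b\<close>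
      reduce to those of \<open>m, a\<close>.\<close>
    have shift: "[v + m = u + a] (mod int p)" if "[m + u = b + v] (mod int p)" for u v
    proof -
      have "[(b + v) + 2 * m = (m + u) + (a + b)] (mod int p)"
        by (rule cong_add[OF cong_sym[OF that] cong_sym[OF mid]])
      then have "[(v + m) + (m + b) = (u + a) + (m + b)] (mod int p)" by (simp add: algebra_simps)
      then show ?thesis by (simp only: cong_add_rcancel)
    qed
    consider "x1 = m" "x2 = a" | "x1 = a" "x2 = m" | "x1 = m" "x2 = b" | "x1 = b" "x2 = m"
      using F by (auto simp: F_def)
    then have "[x3 + m = x4 + a] (mod int p) \<or> [x4 + m = x3 + a] (mod int p)"
    proof cases
      case 1 with r show ?thesis by (simp add: add.commute)
    next
      case 2 with r show ?thesis by (simp add: cong_sym add.commute)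
    next
      case 3 with r shift[of x3 x4] show ?thesis by simp
    next
      case 4 with r shift[of x4 x3] show ?thesis by (simp add: cong_sym)
    qed
    then show ?thesis using diff[of x3 x4] diff[of x4 x3] x by (auto simp: F_def)
  qed
  have crossing: "{x1, x2, x3, x4} \<subseteq> S \<and> [x1 + x3 = x2 + x4] (mod int p)"
    if "c < n" "crossing_colors \<alpha> over C c = (x1, x2, x3, x4)" for c x1 x2 x3 x4
    using that dehn crossing_colors_in[OF that] by (simp add: dehn_coloring_iff S_def)
  have inv: "\<forall>c<n. \<forall>x1 x2 x3 x4. crossing_colors \<alpha> over C c = (x1, x2, x3, x4) \<longrightarrow>
      F x1 x3 = F x2 x4 \<and> F x1 x2 = F x3 x4"
  proof (intro allI impI)
    fix c x1 x2 x3 x4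
    assume "c < n" "crossing_colors \<alpha> over C c = (x1, x2, x3, x4)"
    from crossing[OF this] have x: "x1 \<in> S" "x2 \<in> S" "x3 \<in> S" "x4 \<in> S"
      and r: "[x1 + x3 = x2 + x4] (mod int p)" by auto
    have "[x3 + x1 = x4 + x2] (mod int p)" using r by (simp add: add.commute)
    then show "F x1 x3 = F x2 x4 \<and> F x1 x2 = F x3 x4"
      using over_F[OF _ r x(2,4)] over_F[OF _ cong_sym[OF r] x(1,3)]
        under_F[OF _ r x(3,4)] under_F[OF _ _ x(1,2), of x3 x4] by blast
  qed
  have parity: "((x1 = b) \<longleftrightarrow> (x3 = b)) = ((x2 = b) \<longleftrightarrow> (x4 = b))"
    if c: "c < n" "crossing_colors \<alpha> over C c = (x1, x2, x3, x4)" for c x1 x2 x3 x4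
  proof (rule ccontr)
    assume odd: "((x1 = b) \<longleftrightarrow> (x3 = b)) \<noteq> ((x2 = b) \<longleftrightarrow> (x4 = b))"
    from crossing[OF c] have x: "x1 \<in> S" "x2 \<in> S" "x3 \<in> S" "x4 \<in> S"
      and r: "[x1 + x3 = x2 + x4] (mod int p)" by auto
    have perms: "[x3 + x1 = x2 + x4] (mod int p)" "[x2 + x4 = x1 + x3] (mod int p)"
      "[x4 + x2 = x1 + x3] (mod int p)"
      using r by (simp_all add: cong_sym add.commute)
    \<comment> \<open>Three occurrences of \<open>b\<close> would force the fourth, so
      \<open>b\<close> occurs exactly once.\<close>
    have "x1 = x2 \<longleftrightarrow> x3 = x4" "x1 = x4 \<longleftrightarrow> x3 = x2" using cancel[OF r] x by blast+
    with odd consider "x1 = b" "x2 \<noteq> b" "x3 \<noteq> b" "x4 \<noteq> b" | "x2 = b" "x1 \<noteq> b" "x3 \<noteq> b" "x4 \<noteq> b"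
      | "x3 = b" "x1 \<noteq> b" "x2 \<noteq> b" "x4 \<noteq> b" | "x4 = b" "x1 \<noteq> b" "x2 \<noteq> b" "x3 \<noteq> b"
      by blast
    then have "\<not> F x1 x3 \<and> F x1 x2"
    proof cases
      case 1 with lone[of x3 x2 x4] r x mab show ?thesis by (auto simp: F_def)
    next
      case 2 with lone[of x4 x1 x3] perms x mab show ?thesis by (auto simp: F_def)
    next
      case 3 with lone[of x1 x2 x4] perms x mab show ?thesis by (auto simp: F_def)
    next
      case 4 with lone[of x2 x1 x3] perms x mab show ?thesis by (auto simp: F_def)
    qed
    with adjacent_invariant_crossing[OF sym inv c] show False by simp
  qed
  have "(m = b) = (b = b)"
    by (rule minimal_parity_constant[where y = "\<lambda>x. x = b", OF C])
      (fact min, fact parity, fact mab(1)[unfolded S_def], fact mab(3)[unfolded S_def])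
  with mab show False by simp
qed

text \<open>The number \<open>k\<close> counts the colors beside a normalised progression
  \<open>0\<close>, \<open>1\<close>, \<open>2\<close>; the bound \<open>k \<le> 3\<close> keeps the
  palette within the six elements covered by the progression-free case.\<close>

lemma minimal_card_colors:
  assumes C: "nontrivial_dehn_coloring p n \<alpha> over C"
    and min: "\<And>C'. nontrivial_dehn_coloring p n \<alpha> over C' \<Longrightarrow>
      card (C ` regions n \<alpha>) \<le> card (C' ` regions n \<alpha>)"
    and p: "prime p" "p > 3" and k: "k \<le> 3"
    and check: "all_short_subseqs (palette_check (int p)) k [3..int p - 1]"
  shows "card (C ` regions n \<alpha>) > k + 3"
proof (rule ccontr)
  define S where "S = C ` regions n \<alpha>"
  assume "\<not> card (C ` regions n \<alpha>) > k + 3"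
  then have card: "card S \<le> k + 3" by (simp add: S_def)
  have odd: "odd (int p)" using p prime_odd_nat[of p] by simp
  have dehn: "dehn_coloring p n \<alpha> over C" using C by (simp add: nontrivial_dehn_coloring_def)
  then have S: "S \<subseteq> {0..<int p}" by (simp add: dehn_coloring_iff S_def)
  \<comment> \<open>This is needed for \<open>C\<close> to find a progression, and then for the
    affine image of \<open>C\<close>, which has equally many colors and so is minimal too.\<close>
  have respects_constant: "y u = y v"
    if "nontrivial_dehn_coloring p n \<alpha> over D" "card (D ` regions n \<alpha>) = card S"
      "respects_sums (int p) (D ` regions n \<alpha>) y" "u \<in> D ` regions n \<alpha>" "v \<in> D ` regions n \<alpha>"
    for D y u v
  proof (rule minimal_parity_constant[OF that(1) _ _ that(4,5)])
    show "card (D ` regions n \<alpha>) \<le> card (C' ` regions n \<alpha>)"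
      if "nontrivial_dehn_coloring p n \<alpha> over C'" for C'
      using min[OF that] \<open>card (D ` regions n \<alpha>) = card S\<close> by (simp add: S_def)
  next
    fix c x1 x2 x3 x4
    assume c: "c < n" "crossing_colors \<alpha> over D c = (x1, x2, x3, x4)"
    then have "[x1 + x3 = x2 + x4] (mod int p)"
      using that(1) by (simp add: nontrivial_dehn_coloring_def dehn_coloring_iff)
    moreover have "x1 \<in> D ` regions n \<alpha>" "x2 \<in> D ` regions n \<alpha>"
      "x3 \<in> D ` regions n \<alpha>" "x4 \<in> D ` regions n \<alpha>"
      using crossing_colors_in[OF c] by simp_all
    ultimately show "(y x1 \<longleftrightarrow> y x3) = (y x2 \<longleftrightarrow> y x4)"
      using that(3)[unfolded respects_sums_def, rule_format, of x1 x2 x3 x4] by simp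
  qed
  obtain c where c: "c < n" "\<not> trivially_colored \<alpha> C c"
    using C by (auto simp: nontrivial_dehn_coloring_def)
  obtain x1 x2 x3 x4 where x: "crossing_colors \<alpha> over C c = (x1, x2, x3, x4)"
    by (metis prod_cases4)
  obtain s t where st: "s \<in> S" "t \<in> S" "s \<noteq> t"
    using crossing_colors_in[OF c(1) x] c(2) unfolding trivially_colored_iff[OF x] S_def by auto
  have "\<exists>a b m. a \<in> S \<and> b \<in> S \<and> m \<in> S \<and> [a + b = 2 * m] (mod int p) \<and> a \<noteq> b"
  proof (rule ccontr)
    assume "\<not> ?thesis"
    then have free: "\<And>a b m. a \<in> S \<Longrightarrow> b \<in> S \<Longrightarrow> m \<in> S \<Longrightarrow> [a + b = 2 * m] (mod int p) \<Longrightarrow> a = b"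
      by blast
    have "card S \<le> 6" using card k by simp
    from progression_free_respects_sums[OF S this odd st free]
    obtain y u v where "respects_sums (int p) S y" "u \<in> S" "v \<in> S" "y u \<noteq> y v" .
    then show False using respects_constant[OF C, of y u v] by (simp add: S_def)
  qed
  then obtain a b m where abm: "a \<in> S" "b \<in> S" "m \<in> S" "[a + b = 2 * m] (mod int p)" "a \<noteq> b"
    by blast
  have "m \<noteq> a"
  proof
    assume "m = a"
    with abm(4) have "[a + b = a + a] (mod int p)" by simp
    then have "[b = a] (mod int p)" by (simp only: cong_add_lcancel)
    then show False using abm S by (auto dest: residue_eqI)
  qed
  have "coprime (m - a) (int p)"
  proof -
    have "\<not> int p dvd m - a"
      using \<open>m \<noteq> a\<close> subsetD[OF S abm(1)] subsetD[OF S abm(3)] residue_eqI[of m a "int p"]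
      by (auto simp: cong_iff_dvd_diff)
    then show ?thesis using p(1) by (simp add: prime_imp_coprime coprime_commute)
  qed
  \<comment> \<open>The inverse \<open>t\<close> of \<open>m - a\<close> scales the progression
    \<open>a, m, b\<close> to \<open>0, 1, 2\<close>.\<close>
  then obtain t where t: "[(m - a) * t = 1] (mod int p)" using cong_solve_coprime_int by blast
  have cop: "coprime t (int p)"
    using t by (metis coprime_iff_invertible_int mult.commute)

  define f where "f x = (t * (x - a)) mod int p" for x
  define D where "D = (\<lambda>R. f (C R))"
  have D: "nontrivial_dehn_coloring p n \<alpha> over D" and cardD: "card (D ` regions n \<alpha>) = card S"
    using affine_nontrivial_coloring[OF C cop _ knot, of a] p by (simp_all add: D_def f_def S_def)
  define T where "T = D ` regions n \<alpha>"
  have T_eq: "T = f ` S" by (simp add: T_def S_def D_def image_image)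
  have T: "T \<subseteq> {0..<int p}" using p by (auto simp: T_eq f_def)
  have "f a = 0" by (simp add: f_def)
  moreover have "f m = 1" using t p by (simp add: f_def cong_def mult.commute)
  moreover have "f b = 2"
  proof -
    have "[(a + b) - 2 * a = 2 * m - 2 * a] (mod int p)" using abm(4) by (intro cong_diff) simp_all
    then have "[t * (b - a) = t * (2 * (m - a))] (mod int p)"
      by (intro cong_mult) (simp_all add: algebra_simps)
    moreover have "[2 * ((m - a) * t) = 2 * 1] (mod int p)" using t by (intro cong_mult) simp_all
    ultimately have "[t * (b - a) = 2] (mod int p)" by (simp add: cong_def algebra_simps)
    then show ?thesis using p by (simp add: f_def cong_def)
  qed
  ultimately have T012: "0 \<in> T" "1 \<in> T" "2 \<in> T" using abm unfolding T_eq by force+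

  define xs where "xs = filter (\<lambda>x. x \<in> T) [3..int p - 1]"
  have set_xs: "set (0 # 1 # 2 # xs) = T" using T T012 by (auto simp: xs_def)
  moreover have "distinct (0 # 1 # 2 # xs)" by (auto simp: xs_def)
  ultimately have "card T = 3 + length xs" using distinct_card by fastforce
  then have "length xs \<le> k" using card cardD by (simp add: T_def)
  then have "palette_check (int p) xs"
    using all_short_subseqs_filter[OF check] by (simp add: xs_def)
  then consider B W where "(B, W) \<in> set (two_colorings [0, 2] (1 # xs))" "\<not> sum_clash (int p) (B, W)" "W \<noteq> []"
    | m b where "isolated_progression (int p) T m ((2 * m - b) mod int p) b"
    unfolding palette_check_def Let_def lazy_ex_iff set_xs
    by (auto simp del: two_colorings.simps split: if_splits)
  then show False
  proof cases
    case 1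
    have BW: "set B \<union> set W = T" using two_colorings_union[OF 1(1)] set_xs by auto
    have "0 \<in> set B" using two_colorings_subset[OF 1(1)] by simp
    moreover obtain w where w: "w \<in> set W" using 1(3) by (cases W) auto
    moreover note no_sum_clash_disjoint[OF 1(2)]
    ultimately have "0 \<notin> set W" by blast
    moreover have "respects_sums (int p) T (\<lambda>x. x \<in> set W)"
      using no_sum_clash_respects_sums[OF 1(2)] T unfolding BW by blast
    ultimately show False
      using respects_constant[OF D cardD, of "\<lambda>x. x \<in> set W" 0 w] w T012 BW by (auto simp: T_def)
  next
    case 2
    show False
    proof (rule minimal_no_isolated_progression[OF D _ 2[unfolded T_def]])
      show "card (D ` regions n \<alpha>) \<le> card (C' ` regions n \<alpha>)"
        if "nontrivial_dehn_coloring p n \<alpha> over C'" for C'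
        using min[OF that] cardD by (simp add: S_def)
      show "[(2 * m - b) mod int p + b = 2 * m] (mod int p)" for m b
        by (simp add: cong_def mod_add_left_eq)
    qed
  qed
qed

end

theorem theorem5p1:
  fixes p n :: nat and \<alpha> :: "nat \<Rightarrow> nat" and over :: "nat \<Rightarrow> bool"
    and C :: "nat set \<Rightarrow> int"
  assumes "p \<in> {13, 29}"
    and "knot_diagram n \<alpha>"
    and "nontrivial_dehn_coloring p n \<alpha> over C"
  shows "int (card (C ` regions n \<alpha>)) \<ge> \<lfloor>log 2 (real p)\<rfloor> + 3"
proof -
  interpret knot n \<alpha> by unfold_locales (rule assms(2))
  \<comment> \<open>The least number of colors on this one diagram suffices, since the bound is
    proved for each diagram separately.\<close>
  obtain D where D: "nontrivial_dehn_coloring p n \<alpha> over D"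
    and min: "\<And>C'. nontrivial_dehn_coloring p n \<alpha> over C' \<Longrightarrow>
      card (D ` regions n \<alpha>) \<le> card (C' ` regions n \<alpha>)"
    using ex_has_least_nat[of "nontrivial_dehn_coloring p n \<alpha> over" C "\<lambda>C. card (C ` regions n \<alpha>)"]
      assms(3) by blast
  consider "p = 13" | "p = 29" using assms(1) by auto
  then show ?thesis
  proof cases
    case 1
    have "\<lfloor>log 2 (13 :: real)\<rfloor> = 3" by (simp add: floor_log_eq_powr_iff)
    \<comment> \<open>More than five colors means at least \<open>3 + 3\<close>, the required
      bound.\<close>
    moreover have "card (D ` regions n \<alpha>) > 2 + 3"
    proof (rule minimal_card_colors[OF D min])
      have eq: "int p = 13" "(13 :: int) - 1 = 12" using 1 by simp_all
      show "all_short_subseqs (palette_check (int p)) 2 [3..int p - 1]"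
        unfolding eq by (rule palette_check_13)
    qed (use 1 in simp_all)
    ultimately show ?thesis using min[OF assms(3)] 1 by simp
  next
    case 2
    have "\<lfloor>log 2 (29 :: real)\<rfloor> = 4" by (simp add: floor_log_eq_powr_iff)
    moreover have "card (D ` regions n \<alpha>) > 3 + 3"
    proof (rule minimal_card_colors[OF D min])
      have eq: "int p = 29" "(29 :: int) - 1 = 28" using 2 by simp_all
      show "all_short_subseqs (palette_check (int p)) 3 [3..int p - 1]"
        unfolding eq by (rule palette_check_29)
    qed (use 2 in simp_all)
    ultimately show ?thesis using min[OF assms(3)] 2 by simp
  qed
qed

end
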